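(* Let $\alpha\neq0$ be a simple root of $f(x)=0$ (so $f'(\alpha)\ne0$) with $f''(\alpha)\neq 0$, and let $q\neq 0$ be a real number. If $$-\frac{|f''(\alpha)|}{(q\alpha^{q-1})^2}\le g''(\alpha^q)\le\frac{|f''(\alpha)|}{(q\alpha^{q-1})^2},$$ then the convergence to $\alpha$ of the $q$th power of the binomial expansion of Newton's method (of any truncation order $N\ge1$) is equal to or faster than that of Newton's method.
   Context: $f$ is a real function of a real variable, $C^2$ near $\alpha$, and $g(t)=f(t^{1/q})$, so $g(x^q)=f(x)$. Newton's method is $x_{k+1}=x_k-\frac{f(x_k)}{f'(x_k)}$. For an integer $N\ge1$, the $q$th power of the binomial expansion of Newton's method of truncation order $N$ is the recurrence $$x_{k+1}^q=\sum_{i=0}^{N}\binom{q}{i}x_k^{q-i}\left[-\frac{f(x_k)}{f'(x_k)}\right]^i,\qquad \binom{q}{i}=\frac{q(q-1)\cdots(q-i+1)}{i!}.$$ Real powers occurring are assumed to be defined as real numbers (e.g. positive base), and $t\mapsto t^{1/q}$ is the inverse of $x\mapsto x^q$ near $\alpha$. If a method has the form $x_{k+1}=\varphi(x_k)$, its asymptotic error constant at $\alpha$ is $\lim_{x\to\alpha}|\varphi(x)-\alpha|/(x-\alpha)^2$. "The convergence of method A to $\alpha$ is equal to or faster than that of method B" means that both methods converge to $\alpha$ from every initial value sufficiently close to $\alpha$, and the asymptotic error constant of A is at most that of B. *)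

theory Defs
  imports "HOL-Analysis.Analysis"
begin

section \<open>Real powers, including negative bases\<close>

text \<open>
  A negative number has a real \<open>q\<close>-th power exactly when \<open>q = m / n\<close> with \<open>n\<close> odd, the power
  then being \<open>(root n x) ^ m\<close> (see \<open>real_pow_root\<close>). The sign depends on the parity of \<open>m\<close>,
  which is the same for all representations of \<open>q\<close> with an odd denominator.
  The base 0 is irrelevant here: all bases are near a nonzero \<open>\<alpha>\<close>.
\<close>

definition real_pow_defined :: "real \<Rightarrow> real \<Rightarrow> bool" where
  "real_pow_defined x q \<longleftrightarrow>
     0 < x \<or> (x < 0 \<and> (\<exists>(m::int) (n::nat). odd n \<and> q = of_int m / of_nat n))"

definition real_pow :: "real \<Rightarrow> real \<Rightarrow> real" where
  "real_pow x q =
     (if x < 0 \<and> \<not> (\<exists>(m::int) (n::nat). odd n \<and> even m \<and> q = of_int m / of_nat n)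
      then - (\<bar>x\<bar> powr q) else \<bar>x\<bar> powr q)"

lemma real_pow_pos: "0 < x \<Longrightarrow> real_pow x q = x powr q"
  by (simp add: real_pow_def)

lemma root_powi_abs:
  assumes "odd (n::nat)" "x \<noteq> 0"
  shows "\<bar>root n x powi m\<bar> = \<bar>x\<bar> powr (of_int m / of_nat n)"
proof -
  have n: "n > 0" using assms(1) by (rule odd_pos)
  have "\<bar>root n x powi m\<bar> = root n \<bar>x\<bar> powi m"
    using n by (simp add: power_int_abs real_root_abs)
  also have "\<dots> = (\<bar>x\<bar> powr (1 / of_nat n)) powr of_int m"
    using n assms(2) by (simp add: root_powr_inverse powr_real_of_int')
  also have "\<dots> = \<bar>x\<bar> powr (of_int m / of_nat n)"
    by (simp add: powr_powr)
  finally show ?thesis .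
qed

lemma real_pow_root:
  assumes n: "odd (n::nat)" and x: "x \<noteq> 0"
  shows "real_pow x (of_int m / of_nat n) = root n x powi m"
proof (cases "x < 0")
  case False
  then have "root n x > 0" using x n by (simp add: odd_pos)
  then have "root n x powi m > 0" by simp
  then show ?thesis using root_powi_abs[OF n x, of m] False by (simp add: real_pow_def)
next
  case True
  have r: "root n x < 0" using True n by (simp add: odd_pos)
  have ex: "(\<exists>(m'::int) (n'::nat). odd n' \<and> even m' \<and>
        (of_int m / of_nat n :: real) = of_int m' / of_nat n') \<longleftrightarrow> even m"
  proof
    assume "\<exists>(m'::int) (n'::nat). odd n' \<and> even m' \<and>
        (of_int m / of_nat n :: real) = of_int m' / of_nat n'"
    then obtain m' :: int and n' :: nat where h: "odd n'" "even m'"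
      "(of_int m / of_nat n :: real) = of_int m' / of_nat n'" by blast
    have "(of_int m :: real) * of_nat n' = of_int m' * of_nat n"
      using h n by (auto simp: field_simps dest!: odd_pos)
    then have "(of_int (m * int n') :: real) = of_int (m' * int n)" by simp
    then have "m * int n' = m' * int n" by (simp only: of_int_eq_iff)
    moreover have "even (m' * int n)" using h by simp
    ultimately have "even (m * int n')" by simp
    then show "even m" using h by simp
  next
    assume "even m"
    then show "\<exists>(m'::int) (n'::nat). odd n' \<and> even m' \<and>
        (of_int m / of_nat n :: real) = of_int m' / of_nat n'" using n by blast
  qed
  show ?thesis
  proof (cases "even m")
    case e: True
    have "root n x powi m = (- root n x) powi m"
      using e by (simp add: power_int_minus_left)
    also have "\<dots> > 0" using r by simp
    finally have "root n x powi m > 0" .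
    then show ?thesis using root_powi_abs[OF n x, of m] True e ex by (simp add: real_pow_def)
  next
    case o: False
    have "root n x powi m = - ((- root n x) powi m)"
      using o by (simp add: power_int_minus_left)
    also have "\<dots> < 0" using r by simp
    finally show ?thesis using root_powi_abs[OF n x, of m] True o ex by (simp add: real_pow_def)
  qed
qed

text \<open>
  \<open>pow_inverse \<alpha> q\<close> is \<open>t \<mapsto> t\<^sup>1\<^sup>/\<^sup>q\<close>, understood as the inverse of \<open>x \<mapsto> x ^ q\<close> near \<open>\<alpha>\<close>:
  for instance \<open>t \<mapsto> - sqrt t\<close> if \<open>\<alpha> < 0\<close> and \<open>q = 2\<close>.
\<close>

definition side :: "real \<Rightarrow> real set" where
  "side \<alpha> = {x. sgn x = sgn \<alpha>}"

definition pow_inverse :: "real \<Rightarrow> real \<Rightarrow> real \<Rightarrow> real" where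
  "pow_inverse \<alpha> q = inv_into (side \<alpha>) (\<lambda>x. real_pow x q)"

lemma inj_on_real_pow:
  assumes "\<alpha> \<noteq> 0" "q \<noteq> 0"
  shows "inj_on (\<lambda>x. real_pow x q) (side \<alpha>)"
proof (rule inj_onI)
  fix x y assume h: "x \<in> side \<alpha>" "y \<in> side \<alpha>" "real_pow x q = real_pow y q"
  have s: "sgn x = sgn y" "x \<noteq> 0" "y \<noteq> 0" using h assms by (auto simp: side_def sgn_if split: if_splits)
  have "\<bar>x\<bar> powr q = \<bar>y\<bar> powr q"
    using h(3) s by (auto simp: real_pow_def sgn_if split: if_splits)
  then have "(\<bar>x\<bar> powr q) powr (1/q) = (\<bar>y\<bar> powr q) powr (1/q)" by simp
  then have "\<bar>x\<bar> = \<bar>y\<bar>" using assms s by (simp add: powr_powr)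
  then show "x = y" using s by (auto simp: sgn_if split: if_splits)
qed

lemma pow_inverse_real_pow:
  "\<alpha> \<noteq> 0 \<Longrightarrow> q \<noteq> 0 \<Longrightarrow> x \<in> side \<alpha> \<Longrightarrow> pow_inverse \<alpha> q (real_pow x q) = x"
  unfolding pow_inverse_def by (rule inv_into_f_f[OF inj_on_real_pow])

lemma pow_inverse_pos:
  assumes "0 < \<alpha>" "q \<noteq> 0" "0 < t"
  shows "pow_inverse \<alpha> q t = t powr (1 / q)"
  using pow_inverse_real_pow[of \<alpha> q "t powr (1/q)"] assms
  by (simp add: side_def real_pow_pos powr_powr)

section \<open>Smoothness and the transformed function\<close>

definition C2_near :: "(real \<Rightarrow> real) \<Rightarrow> real \<Rightarrow> bool" where
  "C2_near f a \<longleftrightarrow> (\<exists>S. open S \<and> a \<in> S \<and> f differentiable_on S \<and>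
     deriv f differentiable_on S \<and> continuous_on S (deriv (deriv f)))"

definition pow_transform :: "(real \<Rightarrow> real) \<Rightarrow> real \<Rightarrow> real \<Rightarrow> real \<Rightarrow> real" where
  "pow_transform f \<alpha> q t = f (pow_inverse \<alpha> q t)"

section \<open>The iterations\<close>

text \<open>
  Each method is given by its iteration function together with the set on which one step is
  meaningful, so that convergence is not obtained from conventions such as \<open>x / 0 = 0\<close>.
\<close>

definition newton_dom :: "(real \<Rightarrow> real) \<Rightarrow> real set" where
  "newton_dom f = {x. f differentiable (at x) \<and> deriv f x \<noteq> 0}"

definition newton :: "(real \<Rightarrow> real) \<Rightarrow> real \<Rightarrow> real" where
  "newton f x = x - f x / deriv f x"

definition binomial_sum :: "(real \<Rightarrow> real) \<Rightarrow> real \<Rightarrow> nat \<Rightarrow> real \<Rightarrow> real" where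
  "binomial_sum f q N x =
     (\<Sum>i=0..N. (q gchoose i) * real_pow x (q - of_nat i) * (- (f x / deriv f x)) ^ i)"

text \<open>
  The last condition says that the recurrence \<open>y ^ q = binomial_sum f q N x\<close> is solvable on the
  side of \<open>\<alpha>\<close>; the solution is then unique and equals \<open>binomial_newton f \<alpha> q N x\<close>.
\<close>

definition binomial_newton_dom ::
  "(real \<Rightarrow> real) \<Rightarrow> real \<Rightarrow> real \<Rightarrow> nat \<Rightarrow> real set" where
  "binomial_newton_dom f \<alpha> q N = {x. x \<in> newton_dom f \<and> x \<in> side \<alpha> \<and>
     (\<exists>y \<in> side \<alpha>. real_pow y q = binomial_sum f q N x)}"

definition binomial_newton ::
  "(real \<Rightarrow> real) \<Rightarrow> real \<Rightarrow> real \<Rightarrow> nat \<Rightarrow> real \<Rightarrow> real" where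
  "binomial_newton f \<alpha> q N x = pow_inverse \<alpha> q (binomial_sum f q N x)"

lemma binomial_newton_recurrence:
  assumes "x \<in> binomial_newton_dom f \<alpha> q N"
  shows "real_pow (binomial_newton f \<alpha> q N x) q = binomial_sum f q N x"
proof -
  have "binomial_sum f q N x \<in> (\<lambda>y. real_pow y q) ` side \<alpha>"
    using assms by (auto simp: binomial_newton_dom_def image_iff intro: sym)
  then show ?thesis
    by (simp add: binomial_newton_def pow_inverse_def f_inv_into_f[where f = "\<lambda>y. real_pow y q"])
qed

section \<open>Comparison of convergence\<close>

definition converges_near :: "real set \<Rightarrow> (real \<Rightarrow> real) \<Rightarrow> real \<Rightarrow> bool" where
  "converges_near D \<phi> \<alpha> \<longleftrightarrow>
     (\<forall>\<^sub>F x in nhds \<alpha>. (\<forall>k. (\<phi> ^^ k) x \<in> D) \<and> (\<lambda>k. (\<phi> ^^ k) x) \<longlonglongrightarrow> \<alpha>)"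

definition has_error_constant :: "(real \<Rightarrow> real) \<Rightarrow> real \<Rightarrow> real \<Rightarrow> bool" where
  "has_error_constant \<phi> \<alpha> c \<longleftrightarrow>
     ((\<lambda>x. \<bar>\<phi> x - \<alpha>\<bar> / (x - \<alpha>)\<^sup>2) \<longlongrightarrow> c) (at \<alpha>)"

definition equal_or_faster ::
  "real set \<Rightarrow> (real \<Rightarrow> real) \<Rightarrow> real set \<Rightarrow> (real \<Rightarrow> real) \<Rightarrow> real \<Rightarrow> bool" where
  "equal_or_faster D \<phi> E \<psi> \<alpha> \<longleftrightarrow>
     converges_near D \<phi> \<alpha> \<and> converges_near E \<psi> \<alpha> \<and>
     (\<exists>c d. has_error_constant \<phi> \<alpha> c \<and> has_error_constant \<psi> \<alpha> d \<and> c \<le> d)"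

end

theory Submission
  imports Defs
begin

text \<open>
  Write \<open>h = f x / f' x\<close> and \<open>u = - h / x\<close>. Factoring out \<open>x ^ q\<close> turns the method into
  \<open>x \<mapsto> x (\<Sum>i\<le>N. (q gchoose i) u ^ i) powr (1 / q)\<close>, which expands as
  \<open>x (1 + u + \<kappa> u\<^sup>2 + o(u\<^sup>2)) = x - h + \<kappa> h\<^sup>2 / x + o(h\<^sup>2)\<close>. Hence its signed error constant is
  Newton's constant \<open>f'' / (2 f')\<close> plus \<open>\<kappa> / \<alpha>\<close>. For \<open>N \<ge> 2\<close> the truncated series agrees with
  \<open>(1 + u) powr q\<close> to second order, so \<open>\<kappa> = 0\<close>. For \<open>N = 1\<close> one has \<open>\<kappa> = (1 - q) / 2\<close>, and the
  constant equals \<open>(q \<alpha> powr (q - 1))\<^sup>2 g'' / (2 f')\<close>, which the hypothesis bounds.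
\<close>

section \<open>Real powers on one side of the origin\<close>

lemma abs_real_pow: "\<bar>real_pow x q\<bar> = \<bar>x\<bar> powr q"
  by (simp add: real_pow_def)

text \<open>The sign of a real power depends only on \<open>q\<close> and on the sign of the base,
  hence is constant on one side of 0. This reduces powers of either sign to \<open>powr\<close> of a
  positive base.\<close>

lemma real_pow_same_side:
  assumes "\<alpha> \<noteq> 0" "x \<in> side \<alpha>"
  shows "real_pow x q = sgn (real_pow \<alpha> q) * \<bar>x\<bar> powr q"
  using assms by (auto simp: real_pow_def side_def sgn_if split: if_splits)

lemma real_pow_defined_same_side:
  assumes "\<alpha> \<noteq> 0" "x \<in> side \<alpha>" "real_pow_defined \<alpha> q"
  shows "real_pow_defined x q"
  using assms by (auto simp: real_pow_defined_def side_def sgn_if split: if_splits)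

text \<open>If \<open>q = m / n\<close> with \<open>n\<close> odd, then
  \<open>q - i = (m - n i) / n\<close> keeps the odd denominator, and
  \<open>root n x ^ (n * i) = x ^ i\<close>. Definedness matters: for negative \<open>x\<close> and
  any other \<open>q\<close>, \<open>real_pow\<close> takes its default negative sign at both
  exponents, which is wrong for odd \<open>i\<close>.\<close>

lemma real_pow_diff_nat:
  assumes "real_pow_defined x q"
  shows "real_pow x (q - of_nat i) = real_pow x q / x ^ i"
proof (cases "0 < x")
  case True
  then show ?thesis by (simp add: real_pow_pos powr_diff powr_realpow)
next
  case False
  with assms obtain m :: int and n :: nat where x: "x < 0" and n: "odd n"
    and q: "q = of_int m / of_nat n"
    by (auto simp: real_pow_defined_def)
  have npos: "n > 0" using n by (rule odd_pos)
  have r: "root n x \<noteq> 0" using x npos by simp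
  have "q - of_nat i = of_int (m - int (n * i)) / of_nat n"
    using npos q by (simp add: field_simps)
  then have "real_pow x (q - of_nat i) = root n x powi (m - int (n * i))"
    using real_pow_root[OF n, of x "m - int (n * i)"] x by simp
  also have "\<dots> = root n x powi m / root n x ^ (n * i)"
    using r by (simp only: power_int_diff power_int_of_nat simp_thms)
  also have "root n x ^ (n * i) = x ^ i"
    using n by (simp add: power_mult odd_real_root_pow)
  finally show ?thesis
    using real_pow_root[OF n, of x m] x q by simp
qed

text \<open>Solves \<open>y ^ q = x ^ q * s\<close> on the side of \<alpha>: the positive factor
  \<open>s powr (1 / q)\<close> leaves the sign of \<open>x\<close> unchanged.\<close>

lemma real_pow_mult_powr_inverse:
  assumes "\<alpha> \<noteq> 0" "q \<noteq> 0" "x \<in> side \<alpha>" "0 < s"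
  shows "x * s powr (1 / q) \<in> side \<alpha>"
    and "real_pow (x * s powr (1 / q)) q = real_pow x q * s"
proof -
  show side: "x * s powr (1 / q) \<in> side \<alpha>"
    using assms by (simp add: side_def sgn_mult)
  show "real_pow (x * s powr (1 / q)) q = real_pow x q * s"
    using assms real_pow_same_side[OF assms(1) side, of q] real_pow_same_side[OF assms(1,3), of q]
    by (simp add: abs_mult powr_mult powr_powr)
qed

lemma eventually_side:
  assumes "\<alpha> \<noteq> 0"
  shows "\<forall>\<^sub>F x in nhds \<alpha>. x \<in> side \<alpha>"
proof (cases "0 < \<alpha>")
  case True
  then have "side \<alpha> = {0<..}" by (auto simp: side_def sgn_if split: if_splits)
  then show ?thesis using True eventually_nhds_in_open[of "{0<..}" \<alpha>] by simp
next
  case False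
  with assms have "\<alpha> < 0" by simp
  moreover from this have "side \<alpha> = {..<0}" by (auto simp: side_def sgn_if split: if_splits)
  ultimately show ?thesis using eventually_nhds_in_open[of "{..<0}" \<alpha>] by simp
qed

text \<open>A closed form that can be differentiated, in place of the choice made by
  \<open>inv_into\<close>. The two \<open>sgn\<close> factors select the branch through
  \<alpha>.\<close>

lemma pow_inverse_eq:
  assumes "\<alpha> \<noteq> 0" "q \<noteq> 0" "0 < sgn (real_pow \<alpha> q) * t"
  shows "pow_inverse \<alpha> q t = sgn \<alpha> * (sgn (real_pow \<alpha> q) * t) powr (1 / q)"
    (is "_ = ?y")
proof -
  define z where "z = sgn (real_pow \<alpha> q) * t"
  have z: "z > 0" using assms(3) by (simp add: z_def)
  have side: "sgn \<alpha> * z powr (1 / q) \<in> side \<alpha>"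
    using z assms(1) by (auto simp: side_def sgn_mult sgn_if)
  have "\<bar>sgn \<alpha> * z powr (1 / q)\<bar> powr q = z"
    using z assms(1,2) by (simp add: abs_mult abs_sgn_eq powr_powr)
  then have "real_pow (sgn \<alpha> * z powr (1 / q)) q = sgn (real_pow \<alpha> q) * z"
    using real_pow_same_side[OF assms(1) side, of q] by simp
  also have "\<dots> = t" using z by (auto simp: z_def sgn_if split: if_splits)
  finally show ?thesis
    using pow_inverse_real_pow[OF assms(1,2) side] by (simp add: z_def)
qed

section \<open>Second-order expansions\<close>

lemma isCont_tendsto_nhds: "isCont f a \<Longrightarrow> (f \<longlongrightarrow> f a) (nhds a)"
  by (simp add: isCont_def tendsto_at_iff_tendsto_nhds)

text \<open>Taylor's formula with Peano remainder: one application of l'Hopital's rule leaves half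
  the difference quotient of \<open>F'\<close> at \<open>a\<close>.\<close>

lemma second_order_limit:
  fixes F F' :: "real \<Rightarrow> real"
  assumes F: "\<forall>\<^sub>F x in nhds a. (F has_real_derivative F' x) (at x)"
    and F': "(F' has_real_derivative c) (at a)"
  shows "((\<lambda>x. (F x - F a - F' a * (x - a)) / (x - a)\<^sup>2) \<longlongrightarrow> c / 2) (at a)"
proof (rule lhopital[where f' = "\<lambda>x. F' x - F' a" and g' = "\<lambda>x. 2 * (x - a)"])
  have "isCont F a"
    using eventually_nhds_x_imp_x[OF F] by (rule DERIV_isCont)
  then show "(\<lambda>x. F x - F a - F' a * (x - a)) \<midarrow>a\<rightarrow> 0"
    by (auto intro!: tendsto_eq_intros simp: isCont_def)
  show "(\<lambda>x. (x - a)\<^sup>2) \<midarrow>a\<rightarrow> 0" by (auto intro!: tendsto_eq_intros)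
  have ne: "\<forall>\<^sub>F x in at a. x \<noteq> a" by (simp add: eventually_at_filter)
  show "\<forall>\<^sub>F x in at a. (x - a)\<^sup>2 \<noteq> 0" using ne by eventually_elim simp
  show "\<forall>\<^sub>F x in at a. 2 * (x - a) \<noteq> 0" using ne by eventually_elim simp
  have "\<forall>\<^sub>F x in at a. (F has_real_derivative F' x) (at x)"
    using F by (simp add: eventually_nhds_conv_at)
  then show "\<forall>\<^sub>F x in at a.
      ((\<lambda>x. F x - F a - F' a * (x - a)) has_real_derivative F' x - F' a) (at x)"
    by eventually_elim (auto intro!: derivative_eq_intros)
  show "\<forall>\<^sub>F x in at a. ((\<lambda>x. (x - a)\<^sup>2) has_real_derivative 2 * (x - a)) (at x)"
    by (auto intro!: always_eventually derivative_eq_intros)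
  have "((\<lambda>x. (F' x - F' a) / (x - a) / 2) \<longlongrightarrow> c / 2) (at a)"
    using F' by (intro tendsto_intros) (simp_all add: has_field_derivative_iff)
  then show "((\<lambda>x. (F' x - F' a) / (2 * (x - a))) \<longlongrightarrow> c / 2) (at a)"
    by (simp add: field_simps)
qed

text \<open>At 0 the function \<open>p powr (1 / q)\<close> has value 1 and derivative
  \<open>q * (1 / q) = 1\<close>. Half its second derivative splits into
  \<open>coeff p 2 / q\<close>, from the curvature of \<open>p\<close>, and
  \<open>(1 - q) / 2\<close>, from that of the power.\<close>

lemma poly_powr_expansion:
  fixes p :: "real poly"
  assumes q: "q \<noteq> 0" and p0: "coeff p 0 = 1" and p1: "coeff p 1 = q"
  shows "((\<lambda>u. (poly p u powr (1 / q) - 1 - u) / u\<^sup>2) \<longlongrightarrow> coeff p 2 / q + (1 - q) / 2) (at 0)"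
proof -
  let ?F' = "\<lambda>u. poly (pderiv p) u * (1 / q * poly p u powr (1 / q - 1))"
  have v0: "poly p 0 = 1" using p0 by (simp add: poly_0_coeff_0)
  have v1: "poly (pderiv p) 0 = q"
    using p1 by (simp add: poly_0_coeff_0 coeff_pderiv)
  have v2: "poly (pderiv (pderiv p)) 0 = 2 * coeff p 2"
    by (simp add: poly_0_coeff_0 coeff_pderiv numeral_2_eq_2)
  have "isCont (poly p) 0" by simp
  then have "\<forall>\<^sub>F u in nhds 0. poly p u > 0"
    using v0 by (intro order_tendstoD(1)[OF isCont_tendsto_nhds]) auto
  then have "\<forall>\<^sub>F u in nhds 0. ((\<lambda>u. poly p u powr (1 / q)) has_real_derivative ?F' u) (at u)"
  proof eventually_elim
    case (elim u)
    show ?case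
      by (rule DERIV_cong[OF DERIV_fun_powr[OF poly_DERIV elim]]) (simp add: mult_ac)
  qed
  moreover have "(?F' has_real_derivative
      2 * coeff p 2 * (1 / q) + q * (1 / q * ((1 / q - 1) * q))) (at 0)"
    using v0 v1 v2 q
    by (auto intro!: derivative_eq_intros DERIV_fun_powr poly_DERIV simp: field_simps)
  ultimately have "((\<lambda>u. (poly p u powr (1 / q) - 1 - u) / u\<^sup>2) \<longlongrightarrow>
      (2 * coeff p 2 * (1 / q) + q * (1 / q * ((1 / q - 1) * q))) / 2) (at 0)"
    using v0 v1 q by (auto dest!: second_order_limit)
  also have "(2 * coeff p 2 * (1 / q) + q * (1 / q * ((1 / q - 1) * q))) / 2
      = coeff p 2 / q + (1 - q) / 2"
    using q by (simp add: field_simps)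
  finally show ?thesis .
qed

section \<open>Local convergence\<close>

lemma C2_near_derivs:
  assumes "C2_near f \<alpha>"
  shows "\<forall>\<^sub>F x in nhds \<alpha>. (f has_real_derivative deriv f x) (at x)"
    and "(deriv f has_real_derivative deriv (deriv f) \<alpha>) (at \<alpha>)"
proof -
  obtain S where S: "open S" "\<alpha> \<in> S" "f differentiable_on S" "deriv f differentiable_on S"
    using assms by (auto simp: C2_near_def)
  have D: "(g has_real_derivative deriv g x) (at x)"
    if "g differentiable_on S" "x \<in> S" for g x
    using that S(1) by (metis DERIV_deriv_iff_real_differentiable differentiable_on_eq_differentiable_at)
  show "(deriv f has_real_derivative deriv (deriv f) \<alpha>) (at \<alpha>)"
    using D S by blast
  show "\<forall>\<^sub>F x in nhds \<alpha>. (f has_real_derivative deriv f x) (at x)"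
    using eventually_nhds_in_open[OF S(1,2)] by eventually_elim (use D S in blast)
qed

text \<open>A finite quadratic error constant makes \<phi> halve the distance to \<alpha> on a small
  ball. Orbits therefore stay in that ball, which lies inside \<open>D\<close>, and converge
  geometrically.\<close>

lemma converges_near_if_error_constant:
  assumes c: "has_error_constant \<phi> \<alpha> c" and fix_\<alpha>: "\<phi> \<alpha> = \<alpha>"
    and dom: "\<forall>\<^sub>F x in nhds \<alpha>. x \<in> D"
  shows "converges_near D \<phi> \<alpha>"
proof -
  \<comment> \<open>Multiplying the quadratic error quotient by the distance gives the linear one,
    which therefore tends to 0.\<close>
  have "((\<lambda>x. \<bar>x - \<alpha>\<bar>) \<longlongrightarrow> 0) (at \<alpha>)" by (auto intro!: tendsto_eq_intros)
  with c have "((\<lambda>x. \<bar>\<phi> x - \<alpha>\<bar> / (x - \<alpha>)\<^sup>2 * \<bar>x - \<alpha>\<bar>) \<longlongrightarrow> c * 0) (at \<alpha>)"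
    unfolding has_error_constant_def by (rule tendsto_mult)
  then have "\<forall>\<^sub>F x in at \<alpha>. \<bar>\<phi> x - \<alpha>\<bar> / (x - \<alpha>)\<^sup>2 * \<bar>x - \<alpha>\<bar> < 1 / 2"
    by (rule order_tendstoD) simp
  then have "\<forall>\<^sub>F x in at \<alpha>. \<bar>\<phi> x - \<alpha>\<bar> \<le> \<bar>x - \<alpha>\<bar> / 2"
  proof (eventually_elim)
    case (elim x)
    show ?case
    proof (cases "x = \<alpha>")
      case False
      define d where "d = \<bar>x - \<alpha>\<bar>"
      have "d > 0" "(x - \<alpha>)\<^sup>2 = d * d"
        using False by (auto simp: d_def power2_eq_square)
      with elim show ?thesis unfolding d_def[symmetric] by (simp add: field_simps)
    qed (simp add: fix_\<alpha>)
  qed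
  \<comment> \<open>The fixed point equation extends the estimate from the punctured to the full
    neighbourhood.\<close>
  then have "\<forall>\<^sub>F x in nhds \<alpha>. x \<in> D \<and> \<bar>\<phi> x - \<alpha>\<bar> \<le> \<bar>x - \<alpha>\<bar> / 2"
    using dom by (simp add: eventually_nhds_conv_at eventually_conj_iff fix_\<alpha>)
  then obtain \<delta> where \<delta>: "\<delta> > 0"
    "\<And>x. \<bar>x - \<alpha>\<bar> < \<delta> \<Longrightarrow> x \<in> D \<and> \<bar>\<phi> x - \<alpha>\<bar> \<le> \<bar>x - \<alpha>\<bar> / 2"
    by (auto simp: eventually_nhds_metric dist_real_def)
  have conv: "(\<forall>k. (\<phi> ^^ k) x \<in> D) \<and> (\<lambda>k. (\<phi> ^^ k) x) \<longlonglongrightarrow> \<alpha>" if x: "\<bar>x - \<alpha>\<bar> < \<delta>" for x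
  proof -
    have small: "\<bar>x - \<alpha>\<bar> * (1 / 2) ^ k < \<delta>" for k
    proof -
      have "(1 / 2 :: real) ^ k \<le> 1" by (simp add: power_le_one)
      then have "\<bar>x - \<alpha>\<bar> * (1 / 2) ^ k \<le> \<bar>x - \<alpha>\<bar>" by (simp add: mult_left_le)
      then show ?thesis using x by (rule le_less_trans)
    qed
    have le: "\<bar>(\<phi> ^^ k) x - \<alpha>\<bar> \<le> \<bar>x - \<alpha>\<bar> * (1 / 2) ^ k" for k
    proof (induction k)
      case (Suc k)
      from \<delta>(2)[OF le_less_trans[OF Suc small]] Suc show ?case by simp
    qed simp
    have "(\<phi> ^^ k) x \<in> D" for k
      using \<delta>(2)[OF le_less_trans[OF le small]] by blast
    moreover have "(\<lambda>k. (\<phi> ^^ k) x - \<alpha>) \<longlonglongrightarrow> 0"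
    proof (rule Lim_null_comparison)
      show "\<forall>\<^sub>F k in sequentially. norm ((\<phi> ^^ k) x - \<alpha>) \<le> \<bar>x - \<alpha>\<bar> * (1 / 2) ^ k"
        using le by (intro always_eventually) simp
      show "(\<lambda>k. \<bar>x - \<alpha>\<bar> * (1 / 2) ^ k) \<longlonglongrightarrow> 0"
        by (intro tendsto_mult_right_zero LIMSEQ_realpow_zero) auto
    qed
    ultimately show ?thesis by (simp add: LIM_zero_iff)
  qed
  show ?thesis
    unfolding converges_near_def eventually_nhds_metric dist_real_def
    using \<delta>(1) conv by blast
qed

section \<open>The two methods near a simple root\<close>

locale simple_root =
  fixes f :: "real \<Rightarrow> real" and \<alpha> :: real
  assumes C2: "C2_near f \<alpha>" and root: "f \<alpha> = 0" and simple: "deriv f \<alpha> \<noteq> 0"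
begin

lemmas f_deriv = C2_near_derivs(1)[OF C2]
lemmas f_deriv2 = C2_near_derivs(2)[OF C2]

lemma deriv_tendsto: "(deriv f \<longlongrightarrow> deriv f \<alpha>) (at \<alpha>)"
  using DERIV_isCont[OF f_deriv2] by (simp add: isCont_def)

lemma eventually_newton_dom: "\<forall>\<^sub>F x in nhds \<alpha>. x \<in> newton_dom f"
proof -
  have "\<forall>\<^sub>F x in at \<alpha>. deriv f x \<noteq> 0"
    using deriv_tendsto simple by (rule tendsto_imp_eventually_ne)
  then have "\<forall>\<^sub>F x in nhds \<alpha>. deriv f x \<noteq> 0"
    using simple by (simp add: eventually_nhds_conv_at)
  with f_deriv show ?thesis
    by eventually_elim (auto simp: newton_dom_def real_differentiable_def)
qed

lemma newton_fixed: "newton f \<alpha> = \<alpha>"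
  by (simp add: newton_def root)

lemma newton_error:
  "((\<lambda>x. (newton f x - \<alpha>) / (x - \<alpha>)\<^sup>2) \<longlongrightarrow> deriv (deriv f) \<alpha> / (2 * deriv f \<alpha>)) (at \<alpha>)"
proof -
  \<comment> \<open>The error is \<open>((x - \<alpha>) f' x - f x) / f' x\<close>. In
    \<open>?a - ?b\<close> the terms \<open>f' \<alpha> (x - \<alpha>)\<close> cancel, which leaves
    this numerator over \<open>(x - \<alpha>)\<^sup>2\<close>; the limits are \<open>f''\<close> for
    \<open>?a\<close> and \<open>f'' / 2\<close> for \<open>?b\<close>.\<close>
  let ?a = "\<lambda>x. (deriv f x - deriv f \<alpha>) / (x - \<alpha>)"
  let ?b = "\<lambda>x. (f x - f \<alpha> - deriv f \<alpha> * (x - \<alpha>)) / (x - \<alpha>)\<^sup>2"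
  have "(?a \<longlongrightarrow> deriv (deriv f) \<alpha>) (at \<alpha>)"
    using f_deriv2 by (simp add: has_field_derivative_iff)
  then have "((\<lambda>x. (?a x - ?b x) / deriv f x) \<longlongrightarrow>
      (deriv (deriv f) \<alpha> - deriv (deriv f) \<alpha> / 2) / deriv f \<alpha>) (at \<alpha>)"
    by (intro tendsto_divide[OF tendsto_diff[OF _ second_order_limit[OF f_deriv f_deriv2]]
        deriv_tendsto simple])
  also have "(deriv (deriv f) \<alpha> - deriv (deriv f) \<alpha> / 2) / deriv f \<alpha>
      = deriv (deriv f) \<alpha> / (2 * deriv f \<alpha>)"
    by (simp add: field_simps)
  finally have lim: "((\<lambda>x. (?a x - ?b x) / deriv f x) \<longlongrightarrow>
      deriv (deriv f) \<alpha> / (2 * deriv f \<alpha>)) (at \<alpha>)" .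
  have "\<forall>\<^sub>F x in at \<alpha>. deriv f x \<noteq> 0"
    using deriv_tendsto simple by (rule tendsto_imp_eventually_ne)
  moreover have "\<forall>\<^sub>F x in at \<alpha>. x \<noteq> \<alpha>" by (simp add: eventually_at_filter)
  ultimately have "\<forall>\<^sub>F x in at \<alpha>. (?a x - ?b x) / deriv f x = (newton f x - \<alpha>) / (x - \<alpha>)\<^sup>2"
  proof eventually_elim
    case (elim x)
    define d where "d = x - \<alpha>"
    have "d \<noteq> 0" using elim by (simp add: d_def)
    then have "?a x - ?b x = ((x - \<alpha>) * deriv f x - f x) / (x - \<alpha>)\<^sup>2"
      unfolding d_def[symmetric] by (simp add: root field_simps power2_eq_square)
    moreover have "newton f x - \<alpha> = ((x - \<alpha>) * deriv f x - f x) / deriv f x"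
      using elim by (simp add: newton_def field_simps)
    ultimately show ?case by simp
  qed
  with lim show ?thesis by (rule Lim_transform_eventually)
qed

lemma newton_step_tendsto: "((\<lambda>x. f x / deriv f x) \<longlongrightarrow> 0) (nhds \<alpha>)"
proof -
  have "isCont (\<lambda>x. f x / deriv f x) \<alpha>"
    using DERIV_isCont[OF f_deriv2] DERIV_isCont[OF eventually_nhds_x_imp_x[OF f_deriv]] simple
    by (intro continuous_intros)
  then show ?thesis
    using isCont_tendsto_nhds by (fastforce simp: root)
qed

text \<open>To first order the Newton step equals the error, so a term in the squared step can be
  measured against \<open>(x - \<alpha>)\<^sup>2\<close>.\<close>

lemma newton_step_ratio: "((\<lambda>x. f x / deriv f x / (x - \<alpha>)) \<longlongrightarrow> 1) (at \<alpha>)"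
proof -
  have "((\<lambda>x. (f x - f \<alpha>) / (x - \<alpha>) / deriv f x) \<longlongrightarrow> deriv f \<alpha> / deriv f \<alpha>) (at \<alpha>)"
    using eventually_nhds_x_imp_x[OF f_deriv] deriv_tendsto simple
    by (intro tendsto_divide) (simp_all add: has_field_derivative_iff)
  then show ?thesis using simple by (simp add: root field_simps)
qed

end

text \<open>The truncated binomial series of \<open>(1 + u) powr q\<close>, taken as a formal
  polynomial so that its derivatives at 0 can be read off the coefficients.\<close>

definition binomial_poly :: "real \<Rightarrow> nat \<Rightarrow> real poly" where
  "binomial_poly q N = (\<Sum>i=0..N. monom (q gchoose i) i)"

lemma coeff_binomial_poly: "coeff (binomial_poly q N) i = (if i \<le> N then q gchoose i else 0)"
  by (simp add: binomial_poly_def coeff_sum if_distrib cong: if_cong)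

lemma poly_binomial_poly: "poly (binomial_poly q N) u = (\<Sum>i=0..N. (q gchoose i) * u ^ i)"
  by (simp add: binomial_poly_def poly_sum poly_monom)

lemma binomial_sum_eq:
  assumes "real_pow_defined x q"
  shows "binomial_sum f q N x
    = real_pow x q * poly (binomial_poly q N) (- (f x / deriv f x) / x)"
  unfolding binomial_sum_def poly_binomial_poly sum_distrib_left
  by (rule sum.cong) (simp_all only: real_pow_diff_nat[OF assms] power_divide, simp)

section \<open>The power of the binomial expansion: domain, error constant and comparison\<close>

locale power_binomial = simple_root +
  fixes q :: real and N :: nat
  assumes nonzero: "\<alpha> \<noteq> 0" and q: "q \<noteq> 0" and pow_def: "real_pow_defined \<alpha> q" and N: "N \<ge> 1"
begin

definition u :: "real \<Rightarrow> real" where "u x = - (f x / deriv f x) / x"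

abbreviation S :: "real \<Rightarrow> real" where "S \<equiv> poly (binomial_poly q N)"

definition \<kappa> :: real where "\<kappa> = (if N \<ge> 2 then 0 else (1 - q) / 2)"

lemma u_tendsto: "(u \<longlongrightarrow> 0) (nhds \<alpha>)"
  using tendsto_divide[OF tendsto_minus[OF newton_step_tendsto] filterlim_ident nonzero]
  by (simp add: u_def[abs_def])

text \<open>For \<open>N \<ge> 2\<close> the quadratic coefficient \<open>q (q - 1) / 2\<close>,
  divided by \<open>q\<close>, cancels \<open>(1 - q) / 2\<close>; for \<open>N = 1\<close> that
  coefficient is 0. The bound \<open>N \<ge> 1\<close> supplies the linear coefficient
  \<open>q\<close>.\<close>

lemma S_expansion: "((\<lambda>v. (S v powr (1 / q) - 1 - v) / v\<^sup>2) \<longlongrightarrow> \<kappa>) (at 0)"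
proof -
  have "q gchoose 2 = q * (q - 1) / 2"
    by (simp add: gbinomial_prod_rev numeral_2_eq_2)
  then have "coeff (binomial_poly q N) 2 / q + (1 - q) / 2 = \<kappa>"
    using q by (simp add: \<kappa>_def coeff_binomial_poly field_simps)
  then show ?thesis
    using poly_powr_expansion[OF q, of "binomial_poly q N"] N by (simp add: coeff_binomial_poly)
qed

lemma eventually_S_pos: "\<forall>\<^sub>F x in nhds \<alpha>. S (u x) > 0"
proof -
  have "((\<lambda>x. S (u x)) \<longlongrightarrow> S 0) (nhds \<alpha>)"
    by (intro tendsto_intros u_tendsto)
  moreover have "S 0 = 1" by (simp add: poly_0_coeff_0 coeff_binomial_poly)
  ultimately show ?thesis by (auto intro: order_tendstoD)
qed

text \<open>Since \<open>u\<close> tends to 0, the factor \<open>S (u x)\<close> is close to 1 and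
  so positive. The recurrence is then solvable on the side of \<alpha>, with an explicit
  solution.\<close>

lemma eventually_binomial_newton:
  "\<forall>\<^sub>F x in nhds \<alpha>. x \<in> binomial_newton_dom f \<alpha> q N \<and>
     binomial_newton f \<alpha> q N x = x * S (u x) powr (1 / q)"
  using eventually_newton_dom eventually_side[OF nonzero] eventually_S_pos
proof eventually_elim
  case (elim x)
  have "binomial_sum f q N x = real_pow x q * S (u x)"
    using binomial_sum_eq[OF real_pow_defined_same_side[OF nonzero elim(2) pow_def]]
    by (simp add: u_def)
  then have eq: "real_pow (x * S (u x) powr (1 / q)) q = binomial_sum f q N x"
    using real_pow_mult_powr_inverse(2)[OF nonzero q elim(2,3)] by simp
  have side: "x * S (u x) powr (1 / q) \<in> side \<alpha>"
    by (rule real_pow_mult_powr_inverse(1)[OF nonzero q elim(2,3)])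
  have "binomial_newton f \<alpha> q N x = x * S (u x) powr (1 / q)"
    unfolding binomial_newton_def eq[symmetric] by (rule pow_inverse_real_pow[OF nonzero q side])
  moreover have "x \<in> binomial_newton_dom f \<alpha> q N"
    unfolding binomial_newton_dom_def using elim(1,2) eq side by blast
  ultimately show ?case by blast
qed

lemma binomial_newton_fixed: "binomial_newton f \<alpha> q N \<alpha> = \<alpha>"
  using eventually_nhds_x_imp_x[OF eventually_binomial_newton]
  by (simp add: u_def root poly_0_coeff_0 coeff_binomial_poly)

lemma binomial_newton_error:
  "((\<lambda>x. (binomial_newton f \<alpha> q N x - \<alpha>) / (x - \<alpha>)\<^sup>2) \<longlongrightarrow>
     deriv (deriv f) \<alpha> / (2 * deriv f \<alpha>) + \<kappa> / \<alpha>) (at \<alpha>)"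
proof -
  \<comment> \<open>Filling in the limit \<kappa> at 0 makes \<open>R\<close> continuous there, so
    it can be composed with \<open>u\<close> without excluding zeros of \<open>u\<close>, and the
    expansion of \<open>S v powr (1 / q)\<close> becomes exact for every \<open>v\<close>.\<close>
  define R where "R v = (if v = 0 then \<kappa> else (S v powr (1 / q) - 1 - v) / v\<^sup>2)" for v
  have S_eq: "S v powr (1 / q) = 1 + v + R v * v\<^sup>2" for v
    by (simp add: R_def poly_0_coeff_0 coeff_binomial_poly)
  have "(R \<longlongrightarrow> \<kappa>) (at 0)"
    using S_expansion by (rule Lim_transform_eventually) (auto simp: R_def eventually_at_filter)
  then have "(R \<longlongrightarrow> \<kappa>) (nhds 0)"
    by (metis R_def tendsto_at_iff_tendsto_nhds)
  from filterlim_compose[OF this u_tendsto] have R: "((\<lambda>x. R (u x)) \<longlongrightarrow> \<kappa>) (at \<alpha>)"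
    by (rule tendsto_mono[OF at_within_le_nhds])
  let ?r = "\<lambda>x. f x / deriv f x / (x - \<alpha>)"
  have "((\<lambda>x. (newton f x - \<alpha>) / (x - \<alpha>)\<^sup>2 + R (u x) * (?r x)\<^sup>2 / x) \<longlongrightarrow>
      deriv (deriv f) \<alpha> / (2 * deriv f \<alpha>) + \<kappa> * 1\<^sup>2 / \<alpha>) (at \<alpha>)"
    using nonzero by (intro tendsto_intros newton_error R newton_step_ratio)
  moreover have "\<forall>\<^sub>F x in at \<alpha>. (newton f x - \<alpha>) / (x - \<alpha>)\<^sup>2 + R (u x) * (?r x)\<^sup>2 / x
      = (binomial_newton f \<alpha> q N x - \<alpha>) / (x - \<alpha>)\<^sup>2"
  proof -
    have "\<forall>\<^sub>F x in at \<alpha>. x \<noteq> \<alpha>" by (simp add: eventually_at_filter)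
    moreover have "\<forall>\<^sub>F x in at \<alpha>. x \<noteq> 0"
      using tendsto_ident_at nonzero by (rule tendsto_imp_eventually_ne)
    moreover have "\<forall>\<^sub>F x in at \<alpha>. binomial_newton f \<alpha> q N x = x * S (u x) powr (1 / q)"
      using eventually_binomial_newton by (simp add: eventually_nhds_conv_at eventually_conj_iff)
    ultimately show ?thesis
    proof eventually_elim
      case (elim x)
      define h where "h = f x / deriv f x"
      have "binomial_newton f \<alpha> q N x = x * (1 + (- h / x) + R (u x) * (- h / x)\<^sup>2)"
        using elim S_eq[of "u x"] by (simp add: u_def h_def)
      also have "\<dots> = newton f x + R (u x) * h\<^sup>2 / x"
        using elim by (simp add: newton_def h_def[symmetric] field_simps power2_eq_square)
      finally have "binomial_newton f \<alpha> q N x = newton f x + R (u x) * h\<^sup>2 / x" .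
      then show ?case
        unfolding h_def[symmetric]
        by (simp add: power_divide add_divide_distrib diff_divide_distrib mult.commute)
    qed
  qed
  ultimately have "((\<lambda>x. (binomial_newton f \<alpha> q N x - \<alpha>) / (x - \<alpha>)\<^sup>2) \<longlongrightarrow>
      deriv (deriv f) \<alpha> / (2 * deriv f \<alpha>) + \<kappa> * 1\<^sup>2 / \<alpha>) (at \<alpha>)"
    by (rule Lim_transform_eventually)
  then show ?thesis by simp
qed

text \<open>For \<open>g = f o y\<close>, with \<open>y\<close> the local inverse of the power,
  \<open>g'' = f'' y'\<^sup>2 + f' y''\<close>. At \<open>\<alpha> ^ q\<close>, \<open>y'\<close> is
  \<open>1 / (q \<alpha> ^ (q - 1))\<close> up to sign and
  \<open>y'' = - (q - 1) / \<alpha> * y'\<^sup>2\<close>, so \<open>y'\<^sup>2\<close> factors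
  out.\<close>

lemma deriv2_pow_transform:
  "deriv (deriv (pow_transform f \<alpha> q)) (real_pow \<alpha> q) =
     (deriv (deriv f) \<alpha> - (q - 1) / \<alpha> * deriv f \<alpha>) / (q * real_pow \<alpha> (q - 1))\<^sup>2"
proof -
  \<comment> \<open>The signs of the power and of \<alpha> are split off so that differentiation
    only meets \<open>powr\<close> of a positive base; both square to 1.\<close>
  define \<epsilon> where "\<epsilon> = sgn (real_pow \<alpha> q)"
  define \<sigma> where "\<sigma> = sgn \<alpha>"
  define \<tau> where "\<tau> = real_pow \<alpha> q"
  have "real_pow \<alpha> q \<noteq> 0" using abs_real_pow[of \<alpha> q] nonzero by auto
  then have \<epsilon>: "\<epsilon> * \<epsilon> = 1" by (simp add: \<epsilon>_def sgn_if)
  have \<sigma>: "\<sigma> * \<sigma> = 1" "\<sigma> * \<bar>\<alpha>\<bar> = \<alpha>" using nonzero by (auto simp: \<sigma>_def sgn_if)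
  have \<tau>: "\<epsilon> * \<tau> = \<bar>\<alpha>\<bar> powr q"
    unfolding \<epsilon>_def \<tau>_def abs_real_pow[symmetric] by (simp add: sgn_if)
  have \<tau>pos: "\<epsilon> * \<tau> > 0" using \<tau> nonzero by simp
  define y where "y t = \<sigma> * (\<epsilon> * t) powr (1 / q)" for t
  define y' where "y' t = \<sigma> * (1 / q * (\<epsilon> * t) powr (1 / q - 1) * \<epsilon>)" for t
  have y\<tau>: "y \<tau> = \<alpha>" using nonzero q \<sigma> by (simp add: y_def \<tau> powr_powr)
  have dy: "(y has_real_derivative y' t) (at t)" if "\<epsilon> * t > 0" for t
    unfolding y_def y'_def using that by (auto intro!: derivative_eq_intros DERIV_fun_powr)
  have dy': "(y' has_real_derivative
      \<sigma> * (1 / q * ((1 / q - 1) * (\<epsilon> * \<tau>) powr (1 / q - 1 - 1) * \<epsilon>) * \<epsilon>)) (at \<tau>)"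
    unfolding y'_def using \<tau>pos q by (auto intro!: derivative_eq_intros DERIV_fun_powr)
  have pos: "\<forall>\<^sub>F t in nhds \<tau>. \<epsilon> * t > 0"
    using \<tau>pos by (intro order_tendstoD(1)[of _ "\<epsilon> * \<tau>"]) (auto intro!: tendsto_intros filterlim_ident)
  have g_eq: "\<forall>\<^sub>F t in nhds \<tau>. pow_transform f \<alpha> q t = f (y t)"
    using pos
    by eventually_elim
      (use pow_inverse_eq[OF nonzero q] in \<open>simp add: pow_transform_def y_def \<epsilon>_def \<sigma>_def\<close>)
  have "isCont y \<tau>" using dy[OF \<tau>pos] by (rule DERIV_isCont)
  then have "(y \<longlongrightarrow> \<alpha>) (nhds \<tau>)"
    using isCont_tendsto_nhds by (simp only: y\<tau>[symmetric])
  then have fy: "\<forall>\<^sub>F t in nhds \<tau>. (f has_real_derivative deriv f (y t)) (at (y t))"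
    using f_deriv by (rule filterlim_iff[THEN iffD1, rule_format])
  have "\<forall>\<^sub>F t in nhds \<tau>. deriv (\<lambda>t. f (y t)) t = deriv f (y t) * y' t"
    using fy pos by eventually_elim (rule DERIV_imp_deriv[OF DERIV_chain2[OF _ dy]])
  moreover have "\<forall>\<^sub>F t in nhds \<tau>. deriv (pow_transform f \<alpha> q) t = deriv (\<lambda>t. f (y t)) t"
  proof -
    \<comment> \<open>Replacing \<open>g\<close> by \<open>f o y\<close> under a derivative at
      \<open>t\<close> needs agreement around \<open>t\<close>, not only around \<tau>.\<close>
    have "\<forall>\<^sub>F t in nhds \<tau>. \<forall>\<^sub>F s in nhds t. pow_transform f \<alpha> q s = f (y s)"
      using g_eq by (simp add: eventually_eventually)
    then show ?thesis by eventually_elim (rule deriv_cong_ev, auto)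
  qed
  ultimately have "\<forall>\<^sub>F t in nhds \<tau>. deriv (pow_transform f \<alpha> q) t = deriv f (y t) * y' t"
    by eventually_elim simp
  then have "deriv (deriv (pow_transform f \<alpha> q)) \<tau> = deriv (\<lambda>t. deriv f (y t) * y' t) \<tau>"
    by (rule deriv_cong_ev) simp
  also have "\<dots> = deriv (deriv f) \<alpha> * y' \<tau> * y' \<tau>
      + \<sigma> * (1 / q * ((1 / q - 1) * (\<epsilon> * \<tau>) powr (1 / q - 1 - 1) * \<epsilon>) * \<epsilon>) * deriv f \<alpha>"
  proof -
    have "((\<lambda>t. deriv f (y t)) has_real_derivative deriv (deriv f) \<alpha> * y' \<tau>) (at \<tau>)"
      by (rule DERIV_chain2[OF _ dy[OF \<tau>pos]]) (simp only: y\<tau> f_deriv2)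
    from DERIV_mult[OF this dy'] show ?thesis by (simp add: y\<tau> DERIV_imp_deriv)
  qed
  also have "(\<epsilon> * \<tau>) powr (1 / q - 1 - 1) = 1 / (\<bar>\<alpha>\<bar> * (\<bar>\<alpha>\<bar> powr (q - 1))\<^sup>2)"
  proof -
    \<comment> \<open>The exponent is \<open>q (1 / q - 2) = 1 - 2 q\<close>, arranged to exhibit
      the square of \<open>\<bar>\<alpha>\<bar> powr (q - 1)\<close>.\<close>
    have "(\<epsilon> * \<tau>) powr (1 / q - 1 - 1) = \<bar>\<alpha>\<bar> powr (- (1 + (q - 1) * 2))"
      using q by (simp add: \<tau> powr_powr algebra_simps)
    also have "\<dots> = 1 / (\<bar>\<alpha>\<bar> powr 1 * (\<bar>\<alpha>\<bar> powr (q - 1)) powr 2)"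
      by (simp only: powr_minus_divide powr_add powr_powr)
    finally show ?thesis using nonzero by (simp add: powr_numeral)
  qed
  also have "deriv (deriv f) \<alpha> * y' \<tau> * y' \<tau> = deriv (deriv f) \<alpha> * (y' \<tau> * y' \<tau>)"
    by simp
  also have "y' \<tau> * y' \<tau> = 1 / (q * \<bar>\<alpha>\<bar> powr (q - 1))\<^sup>2"
  proof -
    have "(\<epsilon> * \<tau>) powr (1 / q - 1) = \<bar>\<alpha>\<bar> powr (- (q - 1))"
      using q by (simp add: \<tau> powr_powr algebra_simps)
    also have "\<dots> = 1 / \<bar>\<alpha>\<bar> powr (q - 1)"
      by (rule powr_minus_divide)
    finally have "y' \<tau> * y' \<tau> = (\<sigma> * \<sigma>) * (\<epsilon> * \<epsilon>) / (q * \<bar>\<alpha>\<bar> powr (q - 1))\<^sup>2"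
      by (simp add: y'_def power2_eq_square)
    then show ?thesis by (simp add: \<sigma> \<epsilon>)
  qed
  also have "\<sigma> * (1 / q * ((1 / q - 1) * (1 / (\<bar>\<alpha>\<bar> * (\<bar>\<alpha>\<bar> powr (q - 1))\<^sup>2)) * \<epsilon>) * \<epsilon>) * deriv f \<alpha>
      = - (q - 1) / \<alpha> * deriv f \<alpha> / (q * \<bar>\<alpha>\<bar> powr (q - 1))\<^sup>2"
  proof -
    have "\<sigma> / \<bar>\<alpha>\<bar> = 1 / \<alpha>" using nonzero by (auto simp: \<sigma>_def sgn_if)
    moreover have "1 / q * (1 / q - 1) = - (q - 1) / q\<^sup>2"
      using q by (simp add: field_simps power2_eq_square)
    moreover have "\<sigma> * (1 / q * ((1 / q - 1) * (1 / (\<bar>\<alpha>\<bar> * (\<bar>\<alpha>\<bar> powr (q - 1))\<^sup>2)) * \<epsilon>) * \<epsilon>) * deriv f \<alpha>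
        = (\<epsilon> * \<epsilon>) * (1 / q * (1 / q - 1)) * (\<sigma> / \<bar>\<alpha>\<bar>) * deriv f \<alpha> / (\<bar>\<alpha>\<bar> powr (q - 1))\<^sup>2"
      by (simp add: mult_ac)
    ultimately show ?thesis by (simp add: \<epsilon> power_mult_distrib mult_ac)
  qed
  \<comment> \<open>Squaring removes the sign by which \<open>real_pow\<close> may differ from
    \<open>powr\<close> of the absolute value.\<close>
  also have "(q * \<bar>\<alpha>\<bar> powr (q - 1))\<^sup>2 = (q * real_pow \<alpha> (q - 1))\<^sup>2"
    by (simp add: power_mult_distrib flip: abs_real_pow)
  finally show ?thesis
    by (simp add: \<tau>_def diff_divide_distrib left_diff_distrib)
qed

text \<open>For \<open>N \<ge> 2\<close> the two constants coincide. For \<open>N = 1\<close> the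
  positive square cancels from the hypothesis, leaving
  \<open>\<bar>?e\<bar> \<le> \<bar>f''\<bar>\<close> for the numerator \<open>?e\<close> of
  \<open>g''\<close>; the error constant is \<open>\<bar>?e / (2 f')\<bar>\<close>.\<close>

lemma error_constant_le:
  assumes "\<bar>deriv (deriv (pow_transform f \<alpha> q)) (real_pow \<alpha> q)\<bar>
      \<le> \<bar>deriv (deriv f) \<alpha>\<bar> / (q * real_pow \<alpha> (q - 1))\<^sup>2"
  shows "\<bar>deriv (deriv f) \<alpha> / (2 * deriv f \<alpha>) + \<kappa> / \<alpha>\<bar> \<le> \<bar>deriv (deriv f) \<alpha> / (2 * deriv f \<alpha>)\<bar>"
proof (cases "N \<ge> 2")
  case True
  then show ?thesis by (simp add: \<kappa>_def)
next
  case False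
  let ?e = "deriv (deriv f) \<alpha> - (q - 1) / \<alpha> * deriv f \<alpha>"
  have "real_pow \<alpha> (q - 1) \<noteq> 0" using abs_real_pow[of \<alpha> "q - 1"] nonzero by auto
  then have "(q * real_pow \<alpha> (q - 1))\<^sup>2 > 0" using q by simp
  with assms have "\<bar>?e\<bar> \<le> \<bar>deriv (deriv f) \<alpha>\<bar>"
    unfolding deriv2_pow_transform abs_divide by (simp add: divide_le_cancel)
  moreover have "deriv (deriv f) \<alpha> / (2 * deriv f \<alpha>) + \<kappa> / \<alpha> = ?e / (2 * deriv f \<alpha>)"
    using False nonzero simple by (simp add: \<kappa>_def field_simps)
  ultimately show ?thesis
    by (simp add: divide_right_mono)
qed

lemma equal_or_faster:
  assumes "\<bar>deriv (deriv (pow_transform f \<alpha> q)) (real_pow \<alpha> q)\<bar>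
      \<le> \<bar>deriv (deriv f) \<alpha>\<bar> / (q * real_pow \<alpha> (q - 1))\<^sup>2"
  shows "equal_or_faster (binomial_newton_dom f \<alpha> q N) (binomial_newton f \<alpha> q N)
           (newton_dom f) (newton f) \<alpha>"
proof -
  have "has_error_constant (binomial_newton f \<alpha> q N) \<alpha>
      \<bar>deriv (deriv f) \<alpha> / (2 * deriv f \<alpha>) + \<kappa> / \<alpha>\<bar>"
    using tendsto_rabs[OF binomial_newton_error] by (simp add: has_error_constant_def)
  moreover have "has_error_constant (newton f) \<alpha> \<bar>deriv (deriv f) \<alpha> / (2 * deriv f \<alpha>)\<bar>"
    using tendsto_rabs[OF newton_error] by (simp add: has_error_constant_def)
  moreover have "\<forall>\<^sub>F x in nhds \<alpha>. x \<in> binomial_newton_dom f \<alpha> q N"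
    using eventually_binomial_newton by eventually_elim blast
  ultimately show ?thesis
    unfolding equal_or_faster_def
    using converges_near_if_error_constant binomial_newton_fixed newton_fixed
      eventually_newton_dom error_constant_le[OF assms] by blast
qed

end

theorem theorem4p5:
  fixes f :: "real \<Rightarrow> real" and \<alpha> q :: real and N :: nat
  assumes "C2_near f \<alpha>"
    and "\<alpha> \<noteq> 0" and "f \<alpha> = 0" and "deriv f \<alpha> \<noteq> 0" and "deriv (deriv f) \<alpha> \<noteq> 0"
    and "q \<noteq> 0" and "real_pow_defined \<alpha> q" and "N \<ge> 1"
    and "- (\<bar>deriv (deriv f) \<alpha>\<bar> / (q * real_pow \<alpha> (q - 1))\<^sup>2)
           \<le> deriv (deriv (pow_transform f \<alpha> q)) (real_pow \<alpha> q)"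
    and "deriv (deriv (pow_transform f \<alpha> q)) (real_pow \<alpha> q)
           \<le> \<bar>deriv (deriv f) \<alpha>\<bar> / (q * real_pow \<alpha> (q - 1))\<^sup>2"
  shows "equal_or_faster (binomial_newton_dom f \<alpha> q N) (binomial_newton f \<alpha> q N)
           (newton_dom f) (newton f) \<alpha>"
proof -
  interpret power_binomial f \<alpha> q N
    using assms(1-4,6-8) by unfold_locales
  show ?thesis
    using assms(9,10) by (intro equal_or_faster) (simp add: abs_le_iff)
qed

end
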